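(* Let $\alpha,\beta\ge 0$ with $\alpha+\beta>0$. The space $\mathcal C=(\mathfrak C[-\infty,\infty])^2$ is the direct sum of the two subspaces $\mathcal C_{\alpha,\beta}$ and $\mathcal D_{\alpha,\beta}$: $$\mathcal C=\mathcal C_{\alpha,\beta}\oplus\mathcal D_{\alpha,\beta}.$$ Moreover, $P_{\alpha,\beta}$ is a projection on $\mathcal C_{\alpha,\beta}$ and $Q_{\alpha,\beta}=I_{\mathcal C}-P_{\alpha,\beta}$ is a projection on $\mathcal D_{\alpha,\beta}$.
   Context: $\mathfrak C[-\infty,\infty]$ is the space of real continuous functions on $\mathbb R$ with finite limits at $\pm\infty$, with the supremum norm; $\mathcal C=(\mathfrak C[-\infty,\infty])^2$. For continuous $f:\mathbb R\to\mathbb R$: $f^{T}(x)=f(-x)$, $f^e=\frac12(f+f^{T})$, $f^o=\frac12(f-f^{T})$. For $a\in\mathbb R$: $e_a(x)=e^{-ax}$, $\sinh_a(x)=\sinh(ax)$, $\cosh_a(x)=\cosh(ax)$, $x\in\mathbb R$. For continuous $f,g$ on $\mathbb R$, $(f*g)(x)=\int_0^x f(x-y)g(y)\,dy$ for all $x\in\mathbb R$. $\widehat f(\lambda)=\int_0^\infty e^{-\lambda x}f(x)\,dx$. Put $\gamma=\sqrt{2(\alpha^2+\beta^2)}$. $\mathcal C_{\alpha,\beta}$ is the space of $(g_1,g_2)\in\mathcal C$ such that, on $\mathbb R$, $$g_1^o=\alpha\, e_{\alpha+\beta}*(g_2-g_1^{T}),\qquad g_2^o=\beta\, e_{\alpha+\beta}*(g_2-g_1^{T}).$$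 $\mathcal D_{\alpha,\beta}$ is the space of $(g_1,g_2)\in\mathcal C$ such that, on $\mathbb R$, $$g_1^e=-g_2(0)e_{\alpha+\beta}-e_{\alpha+\beta}*(\beta g_2-\alpha g_1^{T}),\qquad g_2^e=g_2(0)e_{\alpha+\beta}+e_{\alpha+\beta}*(\beta g_2-\alpha g_1^{T}).$$ For $(f_1,f_2)\in\mathcal C$ put $k_1=\alpha f_1^o+\beta f_2^o$, $k_2=f_1^e-f_2^e$, $c=\widehat{k_1}(\gamma)+\frac{\gamma}{2}\widehat{k_2}(\gamma)$, and define $P_{\alpha,\beta}(f_1,f_2)=(g_1,g_2)$ where, on $\mathbb R$, $$g_1=f_1^e+c\left(\tfrac{2\alpha}{\gamma}\sinh_\gamma-\cosh_\gamma\right)-\left(\tfrac{2\alpha}{\gamma}k_1-\tfrac{\gamma}{2}k_2\right)*\sinh_\gamma+(k_1-\alpha k_2)*\cosh_\gamma,$$ $$g_2=f_2^e+c\left(\tfrac{2\beta}{\gamma}\sinh_\gamma+\cosh_\gamma\right)-\left(\tfrac{2\beta}{\gamma}k_1+\tfrac{\gamma}{2}k_2\right)*\sinh_\gamma-(k_1+\beta k_2)*\cosh_\gamma.$$ $I_{\mathcal C}$ is the identity operator on $\mathcal C$. *)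

theory Defs
  imports "HOL-Analysis.Analysis" "HOL-Library.Set_Algebras"
begin

definition climfun :: "(real \<Rightarrow> real) set" where
  "climfun = {f. continuous_on UNIV f \<and> (\<exists>l. (f \<longlongrightarrow> l) at_top) \<and> (\<exists>l. (f \<longlongrightarrow> l) at_bot)}"

lemma climfunI:
  "continuous_on UNIV f \<Longrightarrow> (f \<longlongrightarrow> l) at_top \<Longrightarrow> (f \<longlongrightarrow> m) at_bot \<Longrightarrow> f \<in> climfun"
  unfolding climfun_def by blast

lemma climfunE:
  assumes "f \<in> climfun"
  obtains l m where "continuous_on UNIV f" "(f \<longlongrightarrow> l) at_top" "(f \<longlongrightarrow> m) at_bot"
  using assms unfolding climfun_def by blast

lemma climfun_const: "(\<lambda>x. c) \<in> climfun"
  by (rule climfunI) auto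

lemma climfun_add: "f \<in> climfun \<Longrightarrow> g \<in> climfun \<Longrightarrow> (\<lambda>x. f x + g x) \<in> climfun"
  by (elim climfunE, rule climfunI) (assumption | rule continuous_intros tendsto_intros)+

lemma climfun_scale: "f \<in> climfun \<Longrightarrow> (\<lambda>x. r * f x) \<in> climfun"
  by (elim climfunE, rule climfunI) (assumption | rule continuous_intros tendsto_intros)+

lemma climfun_bounded:
  assumes "f \<in> climfun"
  shows "bounded (range f)"
proof -
  obtain l m where c: "continuous_on UNIV f" and l: "(f \<longlongrightarrow> l) at_top" and m: "(f \<longlongrightarrow> m) at_bot"
    using assms by (rule climfunE)
  obtain b where b: "\<And>x. x \<ge> b \<Longrightarrow> dist (f x) l < 1"
    using tendstoD[OF l, of 1] by (auto simp: eventually_at_top_linorder)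
  obtain a where a: "\<And>x. x \<le> a \<Longrightarrow> dist (f x) m < 1"
    using tendstoD[OF m, of 1] by (auto simp: eventually_at_bot_linorder)
  have "bounded (f ` {a..b})"
    by (intro compact_imp_bounded compact_continuous_image continuous_on_subset[OF c]) auto
  moreover have "range f \<subseteq> ball l 1 \<union> ball m 1 \<union> f ` {a..b}"
  proof
    fix y assume "y \<in> range f"
    then obtain x where "y = f x" by blast
    then show "y \<in> ball l 1 \<union> ball m 1 \<union> f ` {a..b}"
      using a[of x] b[of x] by (cases "x \<le> a"; cases "x \<ge> b") (auto simp: dist_commute)
  qed
  ultimately show ?thesis
    by (meson bounded_Un bounded_ball bounded_subset)
qed

typedef clim = climfun
  morphisms apply_clim Clim
  using climfun_const by blast

setup_lifting type_definition_clim

lemma bdd_above_clim: "bdd_above (range (\<lambda>x. \<bar>apply_clim f x\<bar>))"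
proof -
  have "bounded (range (apply_clim f))"
    using apply_clim climfun_bounded by blast
  then show ?thesis
    unfolding bounded_iff bdd_above_def by auto
qed

instantiation clim :: real_normed_vector
begin

lift_definition zero_clim :: clim is "\<lambda>x. 0" by (rule climfun_const)
lift_definition plus_clim :: "clim \<Rightarrow> clim \<Rightarrow> clim" is "\<lambda>f g x. f x + g x" by (rule climfun_add)
lift_definition scaleR_clim :: "real \<Rightarrow> clim \<Rightarrow> clim" is "\<lambda>r f x. r * f x" by (rule climfun_scale)
lift_definition uminus_clim :: "clim \<Rightarrow> clim" is "\<lambda>f x. - f x"
  using climfun_scale[where r = "-1"] by simp
lift_definition minus_clim :: "clim \<Rightarrow> clim \<Rightarrow> clim" is "\<lambda>f g x. f x - g x"
  using climfun_add climfun_scale[where r = "-1"] by fastforce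

definition norm_clim :: "clim \<Rightarrow> real" where
  "norm_clim f = (SUP x. \<bar>apply_clim f x\<bar>)"

definition sgn_clim :: "clim \<Rightarrow> clim" where
  "sgn_clim f = inverse (norm f) *\<^sub>R f"

definition dist_clim :: "clim \<Rightarrow> clim \<Rightarrow> real" where
  "dist_clim f g = norm (f - g)"

definition uniformity_clim :: "(clim \<times> clim) filter" where
  "uniformity_clim = (INF e\<in>{0<..}. principal {(x, y). dist x y < e})"

definition open_clim :: "clim set \<Rightarrow> bool" where
  "open_clim U = (\<forall>x\<in>U. eventually (\<lambda>(x', y). x' = x \<longrightarrow> y \<in> U) uniformity)"

instance
proof
  fix f g h :: clim and a b :: real
  show "f + g + h = f + (g + h)" "f + g = g + f" "0 + f = f" "- f + f = 0" "f - g = f + - g"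
    by (transfer, simp add: algebra_simps)+
  show "a *\<^sub>R (f + g) = a *\<^sub>R f + a *\<^sub>R g" "(a + b) *\<^sub>R f = a *\<^sub>R f + b *\<^sub>R f"
    "a *\<^sub>R b *\<^sub>R f = (a * b) *\<^sub>R f" "1 *\<^sub>R f = f"
    by (transfer, simp add: algebra_simps)+
  have upper: "\<bar>apply_clim u x\<bar> \<le> norm u" for u x
    unfolding norm_clim_def by (rule cSUP_upper[OF _ bdd_above_clim]) simp
  have least: "norm u \<le> K" if "\<And>x. \<bar>apply_clim u x\<bar> \<le> K" for u K
    unfolding norm_clim_def by (rule cSUP_least) (auto intro: that)
  show "norm f = 0 \<longleftrightarrow> f = 0"
  proof
    assume "norm f = 0"
    then have "apply_clim f = apply_clim 0"
      using upper[of f] by (auto simp: zero_clim.rep_eq)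
    then show "f = 0" by (simp add: apply_clim_inject)
  qed (simp add: norm_clim_def zero_clim.rep_eq)
  show "norm (f + g) \<le> norm f + norm g"
  proof (rule least)
    fix x show "\<bar>apply_clim (f + g) x\<bar> \<le> norm f + norm g"
      using upper[of f x] upper[of g x] by (simp add: plus_clim.rep_eq)
  qed
  show "norm (a *\<^sub>R f) = \<bar>a\<bar> * norm f"
  proof (rule antisym)
    show "norm (a *\<^sub>R f) \<le> \<bar>a\<bar> * norm f"
      by (rule least) (simp add: scaleR_clim.rep_eq abs_mult mult_left_mono upper)
    show "\<bar>a\<bar> * norm f \<le> norm (a *\<^sub>R f)"
    proof (cases "a = 0")
      case True
      then show ?thesis using upper[of "a *\<^sub>R f" 0] by simp
    next
      case False
      have "norm f \<le> norm (a *\<^sub>R f) / \<bar>a\<bar>"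
      proof (rule least)
        fix x show "\<bar>apply_clim f x\<bar> \<le> norm (a *\<^sub>R f) / \<bar>a\<bar>"
          using upper[of "a *\<^sub>R f" x] False
          by (simp add: scaleR_clim.rep_eq abs_mult field_simps)
      qed
      then show ?thesis using False by (simp add: field_simps)
    qed
  qed
qed (rule sgn_clim_def dist_clim_def uniformity_clim_def open_clim_def)+

end

definition refl_fun :: "(real \<Rightarrow> real) \<Rightarrow> real \<Rightarrow> real" where
  "refl_fun f x = f (- x)"

definition even_part :: "(real \<Rightarrow> real) \<Rightarrow> real \<Rightarrow> real" where
  "even_part f x = (f x + refl_fun f x) / 2"

definition odd_part :: "(real \<Rightarrow> real) \<Rightarrow> real \<Rightarrow> real" where
  "odd_part f x = (f x - refl_fun f x) / 2"

definition exp_fun :: "real \<Rightarrow> real \<Rightarrow> real" where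
  "exp_fun a x = exp (- a * x)"

definition sinh_fun :: "real \<Rightarrow> real \<Rightarrow> real" where
  "sinh_fun a x = sinh (a * x)"

definition cosh_fun :: "real \<Rightarrow> real \<Rightarrow> real" where
  "cosh_fun a x = cosh (a * x)"

text \<open>The interval integral is oriented, so for negative \<open>x\<close> this is minus the integral over
  \<open>(x, 0)\<close>, as intended.\<close>

definition conv :: "(real \<Rightarrow> real) \<Rightarrow> (real \<Rightarrow> real) \<Rightarrow> real \<Rightarrow> real" where
  "conv f g x = (LBINT y=ereal 0..ereal x. f (x - y) * g y)"

definition laplace :: "(real \<Rightarrow> real) \<Rightarrow> real \<Rightarrow> real" where
  "laplace f l = (LBINT x:{0..}. exp (- l * x) * f x)"

text \<open>The space of pairs is the product type \<open>clim \<times> clim\<close>; its library norm is the Euclidean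
  combination of the two supremum norms, which is equivalent to their maximum.\<close>

definition C_space :: "real \<Rightarrow> real \<Rightarrow> (clim \<times> clim) set" where
  "C_space \<alpha> \<beta> = {(u, v). let g1 = apply_clim u; g2 = apply_clim v;
       w = conv (exp_fun (\<alpha> + \<beta>)) (\<lambda>y. g2 y - refl_fun g1 y) in
     (\<forall>x. odd_part g1 x = \<alpha> * w x) \<and> (\<forall>x. odd_part g2 x = \<beta> * w x)}"

definition D_space :: "real \<Rightarrow> real \<Rightarrow> (clim \<times> clim) set" where
  "D_space \<alpha> \<beta> = {(u, v). let g1 = apply_clim u; g2 = apply_clim v;
       w = conv (exp_fun (\<alpha> + \<beta>)) (\<lambda>y. \<beta> * g2 y - \<alpha> * refl_fun g1 y) in
     (\<forall>x. even_part g1 x = - g2 0 * exp_fun (\<alpha> + \<beta>) x - w x) \<and>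
     (\<forall>x. even_part g2 x = g2 0 * exp_fun (\<alpha> + \<beta>) x + w x)}"

definition gam :: "real \<Rightarrow> real \<Rightarrow> real" where
  "gam \<alpha> \<beta> = sqrt (2 * (\<alpha>\<^sup>2 + \<beta>\<^sup>2))"

definition k1 :: "real \<Rightarrow> real \<Rightarrow> (real \<Rightarrow> real) \<Rightarrow> (real \<Rightarrow> real) \<Rightarrow> real \<Rightarrow> real" where
  "k1 \<alpha> \<beta> f1 f2 x = \<alpha> * odd_part f1 x + \<beta> * odd_part f2 x"

definition k2 :: "(real \<Rightarrow> real) \<Rightarrow> (real \<Rightarrow> real) \<Rightarrow> real \<Rightarrow> real" where
  "k2 f1 f2 x = even_part f1 x - even_part f2 x"

definition c_coeff :: "real \<Rightarrow> real \<Rightarrow> (real \<Rightarrow> real) \<Rightarrow> (real \<Rightarrow> real) \<Rightarrow> real" where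
  "c_coeff \<alpha> \<beta> f1 f2 =
     laplace (k1 \<alpha> \<beta> f1 f2) (gam \<alpha> \<beta>) + gam \<alpha> \<beta> / 2 * laplace (k2 f1 f2) (gam \<alpha> \<beta>)"

definition P_fun1 :: "real \<Rightarrow> real \<Rightarrow> (real \<Rightarrow> real) \<Rightarrow> (real \<Rightarrow> real) \<Rightarrow> real \<Rightarrow> real" where
  "P_fun1 \<alpha> \<beta> f1 f2 x =
    (let \<gamma> = gam \<alpha> \<beta>; h1 = k1 \<alpha> \<beta> f1 f2; h2 = k2 f1 f2; c = c_coeff \<alpha> \<beta> f1 f2 in
       even_part f1 x
       + c * (2 * \<alpha> / \<gamma> * sinh_fun \<gamma> x - cosh_fun \<gamma> x)
       - conv (\<lambda>y. 2 * \<alpha> / \<gamma> * h1 y - \<gamma> / 2 * h2 y) (sinh_fun \<gamma>) x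
       + conv (\<lambda>y. h1 y - \<alpha> * h2 y) (cosh_fun \<gamma>) x)"

definition P_fun2 :: "real \<Rightarrow> real \<Rightarrow> (real \<Rightarrow> real) \<Rightarrow> (real \<Rightarrow> real) \<Rightarrow> real \<Rightarrow> real" where
  "P_fun2 \<alpha> \<beta> f1 f2 x =
    (let \<gamma> = gam \<alpha> \<beta>; h1 = k1 \<alpha> \<beta> f1 f2; h2 = k2 f1 f2; c = c_coeff \<alpha> \<beta> f1 f2 in
       even_part f2 x
       + c * (2 * \<beta> / \<gamma> * sinh_fun \<gamma> x + cosh_fun \<gamma> x)
       - conv (\<lambda>y. 2 * \<beta> / \<gamma> * h1 y + \<gamma> / 2 * h2 y) (sinh_fun \<gamma>) x
       - conv (\<lambda>y. h1 y + \<beta> * h2 y) (cosh_fun \<gamma>) x)"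

text \<open>\<open>Clim\<close> is unspecified outside \<open>climfun\<close>, so any statement about \<open>P_op\<close> has to
  come with the fact that \<open>P_fun1\<close> and \<open>P_fun2\<close> produce members of \<open>climfun\<close>.\<close>

definition P_op :: "real \<Rightarrow> real \<Rightarrow> clim \<times> clim \<Rightarrow> clim \<times> clim" where
  "P_op \<alpha> \<beta> = (\<lambda>(f1, f2).
     (Clim (P_fun1 \<alpha> \<beta> (apply_clim f1) (apply_clim f2)),
      Clim (P_fun2 \<alpha> \<beta> (apply_clim f1) (apply_clim f2))))"

definition Q_op :: "real \<Rightarrow> real \<Rightarrow> clim \<times> clim \<Rightarrow> clim \<times> clim" where
  "Q_op \<alpha> \<beta> f = id f - P_op \<alpha> \<beta> f"

definition is_direct_sum :: "'a::real_vector set \<Rightarrow> 'a set \<Rightarrow> 'a set \<Rightarrow> bool" where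
  "is_direct_sum X A B \<longleftrightarrow>
     subspace X \<and> subspace A \<and> subspace B \<and> A + B = X \<and> A \<inter> B = {0}"

text \<open>As usual for normed spaces, a projection is a bounded linear idempotent.\<close>

definition is_projection_on :: "('a::real_normed_vector \<Rightarrow> 'a) \<Rightarrow> 'a set \<Rightarrow> bool" where
  "is_projection_on P V \<longleftrightarrow> bounded_linear P \<and> P \<circ> P = P \<and> range P = V"

end

theory Submission imports Defs
begin

text \<open>
  Since \<open>w = e\<^sub>a * h\<close> is the solution of \<open>w' + a w = h\<close> with \<open>w(0) = 0\<close>, both spaces
  are described by differential equations: \<open>(g\<^sub>1, g\<^sub>2)\<close> lies in the first one iff its odd
  parts are \<open>\<alpha> W\<close> and \<open>\<beta> W\<close>, where \<open>W(0) = 0\<close> and \<open>W'\<close> is the even part of \<open>g\<^sub>2 - g\<^sub>1\<close>;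
  it lies in the second one iff its even parts are \<open>- u\<close> and \<open>u\<close>, where \<open>u'\<close> is the odd
  part of \<open>\<alpha> g\<^sub>1 + \<beta> g\<^sub>2\<close>. Splitting a given pair therefore means solving
  \<open>u' = k\<^sub>1 - (\<gamma>\<^sup>2 / 2) W\<close> and \<open>W' = - k\<^sub>2 - 2 u\<close> with \<open>u\<close> even and \<open>W\<close> odd. In the variable
  \<open>p = u - (\<gamma> / 2) W\<close> this is the single equation \<open>p' = \<gamma> p + k\<^sub>1 + (\<gamma> / 2) k\<^sub>2\<close>, which has
  exactly one bounded solution on the line; its value at \<open>0\<close> is \<open>- c\<close>, and \<open>u\<close> and
  \<open>- (\<gamma> / 2) W\<close> are its even and odd parts.
\<close>

section \<open>Convolutions and first-order linear equations\<close>

text \<open>The integral is oriented, so \<open>b < a\<close> is covered as well and convolutions at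
  negative arguments need no case distinction.\<close>

lemma LBINT_FTC:
  fixes f F :: "real \<Rightarrow> real"
  assumes "continuous_on UNIV f" and "\<And>y. (F has_real_derivative f y) (at y)"
  shows "(LBINT y=ereal a..ereal b. f y) = F b - F a"
  using assms
  by (intro interval_integral_FTC_finite)
    (auto intro: continuous_on_subset has_field_derivative_at_within
      simp flip: has_real_derivative_iff_has_vector_derivative)

text \<open>Integrating factors: the equation for \<open>w\<close> makes
  \<open>exp (- a * (x - y)) * w y\<close> a primitive in \<open>y\<close> of the first convolution
  integrand, and \<open>- exp (- a * y) * w (x - y)\<close> one of the second. Since
  \<open>w 0 = 0\<close>, only one endpoint contributes.\<close>

lemma conv_exp_eqI:
  assumes h: "continuous_on UNIV h"
    and w: "\<And>x. (w has_real_derivative h x - a * w x) (at x)" and w0: "w 0 = 0"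
  shows "conv (exp_fun a) h x = w x" and "conv h (exp_fun a) x = w x"
proof -
  have "conv (exp_fun a) h x = exp (- a * (x - x)) * w x - exp (- a * (x - 0)) * w 0"
    unfolding conv_def exp_fun_def
    by (rule LBINT_FTC[where F = "\<lambda>y. exp (- a * (x - y)) * w y"])
      (auto intro!: continuous_intros h derivative_eq_intros w simp: algebra_simps)
  then show "conv (exp_fun a) h x = w x" by (simp add: w0)
  have "conv h (exp_fun a) x = - exp (- a * x) * w (x - x) - (- exp (- a * 0) * w (x - 0))"
    unfolding conv_def exp_fun_def
    by (rule LBINT_FTC[where F = "\<lambda>y. - exp (- a * y) * w (x - y)"])
      (auto intro!: continuous_intros continuous_on_compose2[OF h] derivative_eq_intros
        DERIV_chain2[where f = w, OF w] simp: algebra_simps)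
  then show "conv h (exp_fun a) x = w x" by (simp add: w0)
qed

text \<open>Once some solution with value 0 at 0 exists, \<open>conv_exp_eqI\<close> identifies both
  orders of the convolution with it; commutativity is a by-product.\<close>

lemma conv_exp_ODE:
  assumes h: "continuous_on UNIV h"
  shows "(conv (exp_fun a) h has_real_derivative h x - a * conv (exp_fun a) h x) (at x)"
    and "conv (exp_fun a) h 0 = 0" and "conv h (exp_fun a) = conv (exp_fun a) h"
proof -
  have "continuous_on UNIV (\<lambda>y. exp (a * y) * h y)"
    by (intro continuous_intros h)
  then obtain F where F: "\<And>y. (F has_real_derivative exp (a * y) * h y) (at y)"
    using einterval_antiderivative[of "-\<infinity>" \<infinity> "\<lambda>y. exp (a * y) * h y"]
    by (auto simp: continuous_on_eq_continuous_at has_real_derivative_iff_has_vector_derivative)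
  \<comment> \<open>Variation of constants, with \<open>F\<close> normalised so that
    \<open>w\<close> vanishes at 0.\<close>
  define w where "w y = exp (- a * y) * (F y - F 0)" for y
  have w: "(w has_real_derivative h y - a * w y) (at y)" for y
    unfolding w_def
    by (rule derivative_eq_intros F refl)+ (simp add: algebra_simps flip: exp_add)
  have w0: "w 0 = 0" by (simp add: w_def)
  have eq: "conv (exp_fun a) h = w" "conv h (exp_fun a) = w"
    using conv_exp_eqI[OF h w w0] by auto
  show "(conv (exp_fun a) h has_real_derivative h x - a * conv (exp_fun a) h x) (at x)"
    "conv (exp_fun a) h 0 = 0" "conv h (exp_fun a) = conv (exp_fun a) h"
    using w w0 by (auto simp: eq)
qed

text \<open>Substituting \<open>- y\<close> for \<open>y\<close> reverses the oriented interval,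
  hence the sign. With the parities of \<open>k1\<close> and \<open>k2\<close> this yields the value
  of \<open>aux_sol\<close> at \<open>- x\<close>.\<close>

lemma conv_reflect: "conv f g (- x) = - conv (refl_fun f) (refl_fun g) x"
proof -
  have "conv f g (- x) = (LBINT y=ereal x..ereal 0. f (- x + y) * g (- y))"
    unfolding conv_def by (subst interval_integral_reflect) simp
  also have "\<dots> = - (LBINT y=ereal 0..ereal x. f (- x + y) * g (- y))"
    by (rule interval_integral_endpoints_reverse)
  finally show ?thesis by (simp add: conv_def refl_fun_def)
qed

lemma interval_integrable_continuous_UNIV:
  fixes f :: "real \<Rightarrow> real"
  assumes "continuous_on UNIV f"
  shows "interval_lebesgue_integrable lborel (ereal a) (ereal b) f"
  using assms by (intro interval_integrable_isCont) (simp add: continuous_on_eq_continuous_at)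

lemma conv_lincomb_left:
  assumes "continuous_on UNIV f" "continuous_on UNIV g" "continuous_on UNIV h"
  shows "conv (\<lambda>y. a * f y + b * g y) h x = a * conv f h x + b * conv g h x"
proof -
  have *: "interval_lebesgue_integrable lborel (ereal 0) (ereal x) (\<lambda>y. c * (k (x - y) * h y))"
    if "continuous_on UNIV k" for k c
    by (intro interval_integrable_continuous_UNIV continuous_intros assms
        continuous_on_compose2[OF that]) auto
  have "conv (\<lambda>y. a * f y + b * g y) h x =
      (LBINT y=ereal 0..ereal x. a * (f (x - y) * h y) + b * (g (x - y) * h y))"
    by (simp add: conv_def algebra_simps)
  then show ?thesis
    by (simp add: conv_def interval_lebesgue_integral_add(2)[OF * *] assms)
qed

lemma conv_lincomb_right:
  assumes "continuous_on UNIV f" "continuous_on UNIV g" "continuous_on UNIV h"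
  shows "conv h (\<lambda>y. a * f y + b * g y) x = a * conv h f x + b * conv h g x"
proof -
  have *: "interval_lebesgue_integrable lborel (ereal 0) (ereal x) (\<lambda>y. c * (h (x - y) * k y))"
    if "continuous_on UNIV k" for k c
    by (intro interval_integrable_continuous_UNIV continuous_intros assms that
        continuous_on_compose2[OF assms(3)]) auto
  have "conv h (\<lambda>y. a * f y + b * g y) x =
      (LBINT y=ereal 0..ereal x. a * (h (x - y) * f y) + b * (h (x - y) * g y))"
    by (simp add: conv_def algebra_simps)
  then show ?thesis
    by (simp add: conv_def interval_lebesgue_integral_add(2)[OF * *] assms)
qed

section \<open>The bounded solution of \<open>p' = \<gamma> p + q\<close>\<close>

text \<open>For \<open>\<gamma> > 0\<close> and \<open>q\<close> continuous and bounded this is the only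
  bounded solution of \<open>p' = \<gamma> p + q\<close>.\<close>

definition resolv :: "real \<Rightarrow> (real \<Rightarrow> real) \<Rightarrow> real \<Rightarrow> real" where
  "resolv \<gamma> q x = - laplace (\<lambda>t. q (x + t)) \<gamma>"

text \<open>Computing the nonnegative integral first gives integrability and the value
  together.\<close>

lemma exp_decay_lborel:
  fixes \<gamma> :: real
  assumes "\<gamma> > 0"
  shows "set_integrable lborel {0..} (\<lambda>t. exp (- \<gamma> * t))"
    and "(LBINT t:{0..}. exp (- \<gamma> * t)) = 1 / \<gamma>"
proof -
  have "(\<integral>\<^sup>+t. ennreal (exp (- \<gamma> * t)) * indicator {0..} t \<partial>lborel)
      = ennreal (0 - (- exp (- \<gamma> * 0) / \<gamma>))"
  proof (rule nn_integral_FTC_atLeast[where F = "\<lambda>t. - exp (- \<gamma> * t) / \<gamma>"])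
    have "((\<lambda>t. - exp (- (\<gamma> * t)) / \<gamma>) \<longlongrightarrow> - 0 / \<gamma>) at_top"
      by (intro tendsto_intros filterlim_compose[OF exp_at_bot]
          filterlim_compose[OF filterlim_uminus_at_bot_at_top]
          filterlim_tendsto_pos_mult_at_top[OF tendsto_const assms] filterlim_ident)
        (use assms in auto)
    then show "((\<lambda>t. - exp (- \<gamma> * t) / \<gamma>) \<longlongrightarrow> 0) at_top" by simp
  qed (use assms in \<open>auto intro!: derivative_eq_intros simp: field_simps\<close>)
  then have *: "has_bochner_integral lborel (\<lambda>t. indicator {0..} t * exp (- \<gamma> * t)) (1 / \<gamma>)"
    using assms
    by (intro has_bochner_integral_nn_integral)
      (auto simp: ennreal_mult'' ennreal_indicator mult.commute)
  then show "set_integrable lborel {0..} (\<lambda>t. exp (- \<gamma> * t))"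
    and "(LBINT t:{0..}. exp (- \<gamma> * t)) = 1 / \<gamma>"
    by (auto simp: set_integrable_def set_lebesgue_integral_def has_bochner_integral_iff)
qed

lemma climfun_abs_bound:
  assumes "f \<in> climfun"
  obtains B where "B \<ge> 0" "\<And>x. \<bar>f x\<bar> \<le> B"
  using climfun_bounded[OF assms] that
  by (auto simp: bounded_iff) (meson abs_ge_zero order_trans)

context
  fixes \<gamma> B :: real and q :: "real \<Rightarrow> real"
  assumes g: "\<gamma> > 0" and cq: "continuous_on UNIV q" and B: "\<And>x. \<bar>q x\<bar> \<le> B"
begin

lemma borel_measurable_shift: "(\<lambda>t. q (x + t)) \<in> borel_measurable borel"
  by (intro borel_measurable_continuous_onI continuous_on_compose2[OF cq] continuous_intros) auto

text \<open>The majorant does not depend on \<open>x\<close>, so it serves both integrability and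
  dominated convergence as \<open>x\<close> varies.\<close>

lemma laplace_integrand_le:
  "norm (indicat_real {0..} t *\<^sub>R (exp (- \<gamma> * t) * q (x + t)))
    \<le> indicator {0..} t *\<^sub>R (B * exp (- \<gamma> * t))"
  using B[of "x + t"] by (auto simp: abs_mult indicator_def mult.commute)

lemma set_integrable_laplace:
  "set_integrable lborel {0..} (\<lambda>t. exp (- \<gamma> * t) * q (x + t))"
  unfolding set_integrable_def
proof (rule Bochner_Integration.integrable_bound)
  show "integrable lborel (\<lambda>t. indicator {0..} t *\<^sub>R (B * exp (- \<gamma> * t)))"
    using set_integrable_mult_right[of B, OF exp_decay_lborel(1)[OF g]]
    by (simp add: set_integrable_def)
  show "(\<lambda>t. indicator {0..} t *\<^sub>R (exp (- \<gamma> * t) * q (x + t))) \<in> borel_measurable lborel"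
    using borel_measurable_shift by measurable
  show "AE t in lborel. norm (indicat_real {0..} t *\<^sub>R (exp (- \<gamma> * t) * q (x + t)))
      \<le> norm (indicat_real {0..} t *\<^sub>R (B * exp (- \<gamma> * t)))"
    using laplace_integrand_le by (intro always_eventually allI) (smt (verit) real_norm_def)
qed

lemma abs_resolv_le: "\<bar>resolv \<gamma> q x\<bar> \<le> B / \<gamma>"
proof -
  have "\<bar>resolv \<gamma> q x\<bar> \<le> (LBINT t:{0..}. norm (exp (- \<gamma> * t) * q (x + t)))"
    unfolding resolv_def laplace_def
    using set_integral_norm_bound[OF set_integrable_laplace] by simp
  also have "\<dots> \<le> (LBINT t:{0..}. B * exp (- \<gamma> * t))"
    by (intro set_integral_mono set_integrable_norm[OF set_integrable_laplace]
        set_integrable_mult_right exp_decay_lborel(1) g)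
      (use B in \<open>auto simp: abs_mult mult.commute\<close>)
  also have "\<dots> = B / \<gamma>" using exp_decay_lborel(2)[OF g] by simp
  finally show ?thesis .
qed

text \<open>Dominated convergence: for each fixed \<open>t\<close> the shifted value of
  \<open>q\<close> tends to \<open>l\<close>, and the kernel has total mass
  \<open>1 / \<gamma>\<close>.\<close>

lemma resolv_tendsto:
  assumes F: "(q \<longlongrightarrow> l) F" and "F = at_top \<or> F = at_bot"
  shows "(resolv \<gamma> q \<longlongrightarrow> - l / \<gamma>) F"
proof -
  \<comment> \<open>A general shift \<open>h\<close> lets both limits run along
    \<open>at_top\<close>: \<open>h x = x\<close> for plus infinity and \<open>h x = - x\<close> for
    minus infinity.\<close>
  have *: "((\<lambda>x. laplace (\<lambda>t. q (h x + t)) \<gamma>) \<longlongrightarrow> l / \<gamma>) at_top"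
    if "\<And>t. ((\<lambda>x. q (h x + t)) \<longlongrightarrow> l) at_top" for h :: "real \<Rightarrow> real"
  proof -
    have "((\<lambda>x. laplace (\<lambda>t. q (h x + t)) \<gamma>) \<longlongrightarrow>
        (\<integral>t. indicator {0..} t *\<^sub>R (exp (- \<gamma> * t) * l) \<partial>lborel)) at_top"
      unfolding laplace_def set_lebesgue_integral_def
    proof (rule integral_dominated_convergence_at_top
        [where w = "\<lambda>t. indicator {0..} t *\<^sub>R (B * exp (- \<gamma> * t))"])
      show "integrable lborel (\<lambda>t. indicator {0..} t *\<^sub>R (B * exp (- \<gamma> * t)))"
        using set_integrable_mult_right[of B, OF exp_decay_lborel(1)[OF g]]
        by (simp add: set_integrable_def)
      show "\<forall>\<^sub>F x in at_top. AE t in lborel.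
          norm (indicat_real {0..} t *\<^sub>R (exp (- \<gamma> * t) * q (h x + t)))
          \<le> indicat_real {0..} t *\<^sub>R (B * exp (- \<gamma> * t))"
        using laplace_integrand_le by simp
      show "AE t in lborel. ((\<lambda>x. indicat_real {0..} t *\<^sub>R (exp (- \<gamma> * t) * q (h x + t)))
          \<longlongrightarrow> indicat_real {0..} t *\<^sub>R (exp (- \<gamma> * t) * l)) at_top"
        by (intro always_eventually allI tendsto_intros that)
    qed (use borel_measurable_shift in measurable)
    moreover have "(LBINT t:{0..}. exp (- \<gamma> * t) * l) = l / \<gamma>"
      using exp_decay_lborel(2)[OF g] by (simp only: set_integral_mult_left) simp
    ultimately show ?thesis by (simp only: set_lebesgue_integral_def)
  qed
  from assms(2) show ?thesis
  proof
    assume F': "F = at_top"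
    have "filterlim (\<lambda>x. x + t) at_top at_top" for t :: real
      using filterlim_tendsto_add_at_top[OF tendsto_const[of t] filterlim_ident]
      by (simp only: add.commute[of _ t])
    from filterlim_compose[OF F[unfolded F'] this]
    have "((\<lambda>x. - laplace (\<lambda>t. q (x + t)) \<gamma>) \<longlongrightarrow> - (l / \<gamma>)) at_top"
      by (intro tendsto_minus *)
    then show ?thesis by (simp add: F' resolv_def[abs_def])
  next
    assume F': "F = at_bot"
    have "filterlim (\<lambda>x. - x + t) at_bot at_top" for t :: real
    proof -
      have "filterlim (\<lambda>x. - (- t + x)) at_bot at_top"
        by (intro filterlim_compose[OF filterlim_uminus_at_bot_at_top]
            filterlim_tendsto_add_at_top[OF tendsto_const] filterlim_ident)
      then show ?thesis by (simp add: algebra_simps)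
    qed
    from filterlim_compose[OF F[unfolded F'] this]
    have "((\<lambda>x. - laplace (\<lambda>t. q (- x + t)) \<gamma>) \<longlongrightarrow> - (l / \<gamma>)) at_top"
      by (intro tendsto_minus *)
    then show ?thesis by (simp add: F' resolv_def[abs_def] filterlim_at_bot_mirror)
  qed
qed

text \<open>The integral over the half-line beginning at \<open>x\<close> is the one beginning at 0
  minus the part between 0 and \<open>x\<close>, up to the factor \<open>exp (\<gamma> * x)\<close>.
  In the proof both half-line integrals appear as limits of
  \<open>exp (- \<gamma> * T) * ?w (x + T)\<close>, and the limits are compared.\<close>

lemma resolv_conv: "resolv \<gamma> q x = conv (exp_fun (- \<gamma>)) q x - laplace q \<gamma> * exp (\<gamma> * x)"
proof -
  let ?w = "conv (exp_fun (- \<gamma>)) q"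
  note w = conv_exp_ODE(1)[OF cq, of "- \<gamma>"]
  have lim: "((\<lambda>T. exp (- \<gamma> * T) * ?w (x + T)) \<longlongrightarrow> laplace (\<lambda>t. q (x + t)) \<gamma> + ?w x) at_top" for x
  proof -
    have cont: "continuous_on UNIV (\<lambda>t. exp (- \<gamma> * t) * q (x + t))"
      by (intro continuous_intros continuous_on_compose2[OF cq]) auto
    have "((\<lambda>T. LBINT t:{0..T}. exp (- \<gamma> * t) * q (x + t)) \<longlongrightarrow> laplace (\<lambda>t. q (x + t)) \<gamma>) at_top"
      unfolding laplace_def
      by (intro tendsto_set_lebesgue_integral_at_top set_integrable_laplace) auto
    moreover have "\<forall>\<^sub>F T in at_top. (LBINT t:{0..T}. exp (- \<gamma> * t) * q (x + t))
        = exp (- \<gamma> * T) * ?w (x + T) - ?w x"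
      using eventually_ge_at_top[of 0]
    proof eventually_elim
      case (elim T)
      have "(LBINT t:{0..T}. exp (- \<gamma> * t) * q (x + t))
          = (LBINT t=ereal 0..ereal T. exp (- \<gamma> * t) * q (x + t))"
        using elim by (simp only: interval_integral_Icc)
      also have "\<dots> = exp (- \<gamma> * T) * ?w (x + T) - exp (- \<gamma> * 0) * ?w (x + 0)"
        by (rule LBINT_FTC[OF cont, where F = "\<lambda>t. exp (- \<gamma> * t) * ?w (x + t)"])
          (auto intro!: derivative_eq_intros DERIV_chain2[where f = ?w, OF w] simp: algebra_simps)
      finally show ?case by simp
    qed
    ultimately have "((\<lambda>T. exp (- \<gamma> * T) * ?w (x + T) - ?w x) \<longlongrightarrow> laplace (\<lambda>t. q (x + t)) \<gamma>) at_top"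
      by (rule Lim_transform_eventually)
    from tendsto_add[OF this tendsto_const[of "?w x"]] show ?thesis by simp
  qed
  \<comment> \<open>The limit for base point 0, taken along \<open>x + T\<close> and rescaled so
    that it concerns the same function of \<open>T\<close>.\<close>
  have "((\<lambda>T. exp (\<gamma> * x) * (exp (- \<gamma> * (x + T)) * ?w (0 + (x + T))))
      \<longlongrightarrow> exp (\<gamma> * x) * (laplace (\<lambda>t. q (0 + t)) \<gamma> + ?w 0)) at_top"
    by (intro tendsto_intros filterlim_compose[OF lim]
        filterlim_tendsto_add_at_top[OF tendsto_const] filterlim_ident)
  moreover have "exp (\<gamma> * x) * (exp (- \<gamma> * (x + T)) * y) = exp (- \<gamma> * T) * y" for T y
    by (simp add: mult.assoc[symmetric] flip: exp_add) (simp add: algebra_simps)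
  ultimately have "((\<lambda>T. exp (- \<gamma> * T) * ?w (x + T)) \<longlongrightarrow> exp (\<gamma> * x) * laplace q \<gamma>) at_top"
    by (simp only: conv_exp_ODE(2)[OF cq] add_0_left add_0_right)
  from tendsto_unique[OF trivial_limit_at_top_linorder lim this] show ?thesis
    unfolding resolv_def by (simp only: mult.commute[of "laplace q \<gamma>"])
qed

text \<open>In the closed form a particular solution is corrected by a multiple of the homogeneous
  one, so no differentiation under the integral sign over the half-line is required.\<close>

lemma resolv_ODE: "(resolv \<gamma> q has_real_derivative \<gamma> * resolv \<gamma> q x + q x) (at x)"
  unfolding resolv_conv[abs_def]
  by (auto intro!: derivative_eq_intros conv_exp_ODE(1)[OF cq] simp: algebra_simps)

end

text \<open>The difference of two solutions is a multiple of \<open>exp (\<gamma> * y)\<close>;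
  being bounded as \<open>y\<close> tends to plus infinity, it vanishes.\<close>

lemma bounded_ODE_unique:
  fixes \<gamma> :: real
  assumes "\<gamma> > 0" and "\<And>x. (f has_real_derivative \<gamma> * f x + q x) (at x)"
    and "\<And>x. (g has_real_derivative \<gamma> * g x + q x) (at x)"
    and "\<And>x. \<bar>f x\<bar> \<le> M" and "\<And>x. \<bar>g x\<bar> \<le> N"
  shows "f x = g x"
proof -
  define d where "d y = exp (- \<gamma> * y) * (f y - g y)" for y
  have "(d has_real_derivative 0) (at y)" for y
    unfolding d_def by (rule derivative_eq_intros assms refl)+ (simp add: algebra_simps)
  then have d: "d y = d x" for y
    using DERIV_isconst_all[of d y x] by blast
  have "((\<lambda>y. exp (- \<gamma> * y) * (M + N)) \<longlongrightarrow> 0 * (M + N)) at_top"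
    by (intro tendsto_intros filterlim_compose[OF exp_at_bot]
        filterlim_tendsto_neg_mult_at_bot[OF tendsto_const] filterlim_ident) (use assms in auto)
  moreover have "\<bar>d x\<bar> \<le> exp (- \<gamma> * y) * (M + N)" for y
  proof -
    have "\<bar>d y\<bar> \<le> exp (- \<gamma> * y) * (M + N)"
      using assms(4,5)[of y] unfolding d_def abs_mult by (intro mult_mono) auto
    then show ?thesis using d[of y] by simp
  qed
  ultimately have "\<bar>d x\<bar> \<le> 0"
    by (intro tendsto_lowerbound[of _ 0 at_top "\<bar>d x\<bar>"]) auto
  then show ?thesis by (simp add: d_def)
qed

section \<open>Parity parts and bounded solutions within \<open>climfun\<close>\<close>

lemma climfun_reflect:
  assumes "f \<in> climfun"
  shows "refl_fun f \<in> climfun"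
proof -
  obtain l m where c: "continuous_on UNIV f" and l: "(f \<longlongrightarrow> l) at_top" and m: "(f \<longlongrightarrow> m) at_bot"
    using assms by (rule climfunE)
  have "continuous_on UNIV (\<lambda>x. f (- x))"
    by (rule continuous_on_compose2[OF c]) (auto intro!: continuous_intros)
  then show ?thesis
    unfolding refl_fun_def[abs_def]
    using filterlim_compose[OF m filterlim_uminus_at_bot_at_top]
      filterlim_compose[OF l filterlim_uminus_at_top_at_bot]
    by (rule climfunI)
qed

lemma climfun_lincomb: "f \<in> climfun \<Longrightarrow> g \<in> climfun \<Longrightarrow> (\<lambda>x. a * f x + b * g x) \<in> climfun"
  by (intro climfun_add climfun_scale)

lemma even_part_climfun: "f \<in> climfun \<Longrightarrow> even_part f \<in> climfun"
  using climfun_lincomb[of f "refl_fun f" "1/2" "1/2"] climfun_reflect[of f]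
  by (simp add: even_part_def[abs_def] add_divide_distrib)

lemma odd_part_climfun: "f \<in> climfun \<Longrightarrow> odd_part f \<in> climfun"
  using climfun_lincomb[of f "refl_fun f" "1/2" "-1/2"] climfun_reflect[of f]
  by (simp add: odd_part_def[abs_def] diff_divide_distrib)

lemma k1_climfun: "f1 \<in> climfun \<Longrightarrow> f2 \<in> climfun \<Longrightarrow> k1 \<alpha> \<beta> f1 f2 \<in> climfun"
  unfolding k1_def[abs_def] by (intro climfun_lincomb odd_part_climfun)

lemma k2_climfun: "f1 \<in> climfun \<Longrightarrow> f2 \<in> climfun \<Longrightarrow> k2 f1 f2 \<in> climfun"
  using climfun_lincomb[of "even_part f1" "even_part f2" 1 "-1"]
  by (simp add: k2_def[abs_def] even_part_climfun)

lemma climfun_continuous: "f \<in> climfun \<Longrightarrow> continuous_on UNIV f"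
  by (elim climfunE)

lemma resolv_climfun:
  assumes "\<gamma> > 0" and q: "q \<in> climfun"
  shows "resolv \<gamma> q \<in> climfun"
proof -
  obtain l m where c: "continuous_on UNIV q" and lm: "(q \<longlongrightarrow> l) at_top" "(q \<longlongrightarrow> m) at_bot"
    using q by (rule climfunE)
  obtain B where B: "\<And>x. \<bar>q x\<bar> \<le> B"
    using climfun_abs_bound[OF q] by blast
  show ?thesis
    using resolv_tendsto[OF assms(1) c B] lm resolv_ODE[OF assms(1) c B]
    by (intro climfunI) (auto intro!: DERIV_continuous_on)
qed

lemma resolv_climfun_ODE:
  assumes "\<gamma> > 0" and q: "q \<in> climfun"
  shows "(resolv \<gamma> q has_real_derivative \<gamma> * resolv \<gamma> q x + q x) (at x)"
  using climfun_abs_bound[OF q] resolv_ODE[OF assms(1) climfun_continuous[OF q]] by metis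

text \<open>The working form of uniqueness: exhibiting any solution in \<open>climfun\<close>
  computes \<open>resolv\<close>. Linearity and the action of the projection on both subspaces are
  obtained this way.\<close>

lemma resolv_eqI:
  assumes "\<gamma> > 0" "q \<in> climfun" "p \<in> climfun"
    and "\<And>x. (p has_real_derivative \<gamma> * p x + q x) (at x)"
  shows "resolv \<gamma> q = p"
proof -
  obtain M N where "\<And>x. \<bar>resolv \<gamma> q x\<bar> \<le> M" "\<And>x. \<bar>p x\<bar> \<le> N"
    using climfun_abs_bound resolv_climfun assms(1-3) by metis
  then show ?thesis
    using bounded_ODE_unique[OF assms(1) resolv_climfun_ODE[OF assms(1,2)] assms(4)] by blast
qed

lemma resolv_lincomb:
  assumes "\<gamma> > 0" "q \<in> climfun" "r \<in> climfun"
  shows "resolv \<gamma> (\<lambda>x. a * q x + b * r x) = (\<lambda>x. a * resolv \<gamma> q x + b * resolv \<gamma> r x)"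
  by (rule resolv_eqI)
    (auto intro!: assms climfun_lincomb resolv_climfun derivative_eq_intros resolv_climfun_ODE
      simp: algebra_simps)

section \<open>The projection formulas in terms of one bounded solution\<close>

definition aux_source :: "real \<Rightarrow> real \<Rightarrow> (real \<Rightarrow> real) \<Rightarrow> (real \<Rightarrow> real) \<Rightarrow> real \<Rightarrow> real" where
  "aux_source \<alpha> \<beta> f1 f2 x = k1 \<alpha> \<beta> f1 f2 x + gam \<alpha> \<beta> / 2 * k2 f1 f2 x"

text \<open>This is the function \<open>p\<close> of the overview.\<close>

definition aux_sol :: "real \<Rightarrow> real \<Rightarrow> (real \<Rightarrow> real) \<Rightarrow> (real \<Rightarrow> real) \<Rightarrow> real \<Rightarrow> real" where
  "aux_sol \<alpha> \<beta> f1 f2 = resolv (gam \<alpha> \<beta>) (aux_source \<alpha> \<beta> f1 f2)"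

lemma aux_source_climfun:
  "f1 \<in> climfun \<Longrightarrow> f2 \<in> climfun \<Longrightarrow> aux_source \<alpha> \<beta> f1 f2 \<in> climfun"
  using climfun_lincomb[of "k1 \<alpha> \<beta> f1 f2" "k2 f1 f2" 1 "gam \<alpha> \<beta> / 2"]
  by (simp add: aux_source_def[abs_def] k1_climfun k2_climfun)

text \<open>The transform is minus the value of \<open>resolv\<close> at 0, so linearity is
  inherited from there.\<close>

lemma laplace_lincomb:
  assumes "l > 0" "f \<in> climfun" "g \<in> climfun"
  shows "laplace (\<lambda>x. a * f x + b * g x) l = a * laplace f l + b * laplace g l"
  using fun_cong[OF resolv_lincomb[OF assms, of a b], of 0] by (simp add: resolv_def)

text \<open>By the sign convention of \<open>exp_fun\<close>, the exponential
  \<open>exp (a * x)\<close> is \<open>exp_fun (- a)\<close>.\<close>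

lemma conv_sinh:
  assumes "continuous_on UNIV h"
  shows "conv h (sinh_fun a) x = (conv h (exp_fun (- a)) x - conv h (exp_fun a) x) / 2"
proof -
  have "sinh_fun a = (\<lambda>y. 1/2 * exp_fun (- a) y + (-1/2) * exp_fun a y)"
    by (simp add: fun_eq_iff sinh_fun_def exp_fun_def sinh_field_def diff_divide_distrib)
  moreover have "continuous_on UNIV (exp_fun c)" for c
    unfolding exp_fun_def[abs_def] by (intro continuous_intros)
  ultimately show ?thesis
    using assms by (simp only: conv_lincomb_right) (simp add: diff_divide_distrib)
qed

lemma conv_cosh:
  assumes "continuous_on UNIV h"
  shows "conv h (cosh_fun a) x = (conv h (exp_fun (- a)) x + conv h (exp_fun a) x) / 2"
proof -
  have "cosh_fun a = (\<lambda>y. 1/2 * exp_fun (- a) y + 1/2 * exp_fun a y)"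
    by (simp add: fun_eq_iff cosh_fun_def exp_fun_def cosh_field_def add_divide_distrib)
  moreover have "continuous_on UNIV (exp_fun c)" for c
    unfolding exp_fun_def[abs_def] by (intro continuous_intros)
  ultimately show ?thesis
    using assms by (simp only: conv_lincomb_right) (simp add: add_divide_distrib)
qed

lemma sinh_cosh_fun_continuous: "continuous_on UNIV (sinh_fun a)" "continuous_on UNIV (cosh_fun a)"
  unfolding sinh_fun_def[abs_def] cosh_fun_def[abs_def] by (intro continuous_intros)+

lemma parts_simps:
  "even_part f (- x) = even_part f x" "odd_part f (- x) = - odd_part f x" "odd_part f 0 = 0"
  "k1 \<alpha> \<beta> f1 f2 (- x) = - k1 \<alpha> \<beta> f1 f2 x" "k2 f1 f2 (- x) = k2 f1 f2 x"
  by (auto simp: even_part_def odd_part_def refl_fun_def k1_def k2_def field_simps)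

text \<open>By \<open>resolv_conv\<close> the value of \<open>aux_sol\<close> at \<open>x\<close>
  consists of convolutions with \<open>exp (\<gamma> * x)\<close> and a multiple of that
  exponential; the parities of \<open>k1\<close> and \<open>k2\<close> give the value at
  \<open>- x\<close>. Half the sum and half the difference then produce exactly the hyperbolic terms
  of the definition.\<close>

lemma P_fun_eq:
  assumes "gam \<alpha> \<beta> > 0" "f1 \<in> climfun" "f2 \<in> climfun"
  shows "P_fun1 \<alpha> \<beta> f1 f2 x = even_part f1 x + even_part (aux_sol \<alpha> \<beta> f1 f2) x
      - 2 * \<alpha> / gam \<alpha> \<beta> * odd_part (aux_sol \<alpha> \<beta> f1 f2) x" (is ?th1)
    and "P_fun2 \<alpha> \<beta> f1 f2 x = even_part f2 x - even_part (aux_sol \<alpha> \<beta> f1 f2) x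
      - 2 * \<beta> / gam \<alpha> \<beta> * odd_part (aux_sol \<alpha> \<beta> f1 f2) x" (is ?th2)
proof -
  define \<gamma> where "\<gamma> = gam \<alpha> \<beta>"
  define h1 where "h1 = k1 \<alpha> \<beta> f1 f2"
  define h2 where "h2 = k2 f1 f2"
  define c where "c = c_coeff \<alpha> \<beta> f1 f2"
  note [simp] = \<gamma>_def[symmetric] h1_def[symmetric] h2_def[symmetric] c_def[symmetric]
  have g: "\<gamma> > 0" using assms by simp
  have cl: "h1 \<in> climfun" "h2 \<in> climfun"
    using assms by (auto simp: h1_def h2_def k1_climfun k2_climfun
        simp del: h1_def[symmetric] h2_def[symmetric])
  note cont = climfun_continuous[OF cl(1)] climfun_continuous[OF cl(2)]
  have econt: "continuous_on UNIV (exp_fun a)" for a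
    unfolding exp_fun_def[abs_def] by (intro continuous_intros)
  have src: "aux_source \<alpha> \<beta> f1 f2 = (\<lambda>x. 1 * h1 x + \<gamma> / 2 * h2 x)"
    by (simp add: aux_source_def fun_eq_iff)
  obtain B where B: "\<And>x. \<bar>aux_source \<alpha> \<beta> f1 f2 x\<bar> \<le> B"
    using climfun_abs_bound[OF aux_source_climfun[OF assms(2,3)]] by metis
  have p: "aux_sol \<alpha> \<beta> f1 f2 x = conv h1 (exp_fun (- \<gamma>)) x + \<gamma> / 2 * conv h2 (exp_fun (- \<gamma>)) x
      - c * exp (\<gamma> * x)" for x
  proof -
    have "laplace (aux_source \<alpha> \<beta> f1 f2) \<gamma> = c"
      unfolding src laplace_lincomb[OF g cl] by (simp add: c_def c_coeff_def del: c_def[symmetric])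
    moreover have "continuous_on UNIV (aux_source \<alpha> \<beta> f1 f2)"
      by (intro climfun_continuous aux_source_climfun assms)
    ultimately have "aux_sol \<alpha> \<beta> f1 f2 x
        = conv (aux_source \<alpha> \<beta> f1 f2) (exp_fun (- \<gamma>)) x - c * exp (\<gamma> * x)"
      using resolv_conv[OF g _ B] by (simp add: aux_sol_def conv_exp_ODE(3))
    then show ?thesis unfolding src conv_lincomb_left[OF cont econt] by simp
  qed
  \<comment> \<open>The sign is written as a two-term combination so that
    \<open>conv_lincomb_left\<close> can extract it.\<close>
  have "refl_fun h1 = (\<lambda>y. (-1) * h1 y + 0 * h1 y)" "refl_fun h2 = h2"
    and "refl_fun (exp_fun (- \<gamma>)) = exp_fun \<gamma>"
    by (simp_all only: h1_def h2_def)
      (auto simp: refl_fun_def fun_eq_iff parts_simps exp_fun_def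
        simp del: h1_def[symmetric] h2_def[symmetric])
  then have "conv h1 (exp_fun (- \<gamma>)) (- x) = conv h1 (exp_fun \<gamma>) x"
    "conv h2 (exp_fun (- \<gamma>)) (- x) = - conv h2 (exp_fun \<gamma>) x"
    by (simp_all only: conv_reflect conv_lincomb_left[OF cont(1,1) econt])
  then have q: "aux_sol \<alpha> \<beta> f1 f2 (- x) = conv h1 (exp_fun \<gamma>) x - \<gamma> / 2 * conv h2 (exp_fun \<gamma>) x
      - c * exp (- (\<gamma> * x))"
    by (simp add: p)
  note lin = conv_lincomb_left[OF cont sinh_cosh_fun_continuous(1)]
    conv_lincomb_left[OF cont sinh_cosh_fun_continuous(2)]
  \<comment> \<open>Brings the left factors in the definitions to the shape expected by
    \<open>lin\<close>.\<close>
  have s: "(\<lambda>y. a * h1 y - b * h2 y) = (\<lambda>y. a * h1 y + (- b) * h2 y)"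
    "(\<lambda>y. h1 y - b * h2 y) = (\<lambda>y. 1 * h1 y + (- b) * h2 y)"
    "(\<lambda>y. h1 y + b * h2 y) = (\<lambda>y. 1 * h1 y + b * h2 y)" for a b
    by simp_all
  show ?th1 ?th2
    unfolding P_fun1_def P_fun2_def Let_def
      \<gamma>_def[symmetric] h1_def[symmetric] h2_def[symmetric] c_def[symmetric]
      s lin conv_sinh[OF cont(1)] conv_sinh[OF cont(2)] conv_cosh[OF cont(1)] conv_cosh[OF cont(2)]
      even_part_def[of "aux_sol \<alpha> \<beta> f1 f2"] odd_part_def[of "aux_sol \<alpha> \<beta> f1 f2"]
      refl_fun_def[of "aux_sol \<alpha> \<beta> f1 f2"] p[of x] q
      sinh_fun_def cosh_fun_def sinh_field_def cosh_field_def
    using g by (simp_all add: field_simps)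
qed

section \<open>Parity, linearity and bounds for the projection formulas\<close>

lemma gam_pos:
  assumes "\<alpha> \<ge> 0" "\<beta> \<ge> 0" "\<alpha> + \<beta> > 0"
  shows "gam \<alpha> \<beta> > 0"
proof -
  have "\<alpha> \<noteq> 0 \<or> \<beta> \<noteq> 0" using assms by linarith
  then show ?thesis by (simp add: gam_def sum_power2_gt_zero_iff del: distrib_left_numeral)
qed

lemma gam_square: "gam \<alpha> \<beta> * gam \<alpha> \<beta> = 2 * (\<alpha> * \<alpha> + \<beta> * \<beta>)"
  by (simp add: gam_def power2_eq_square)

lemma even_part_DERIV:
  assumes "\<And>x. (p has_real_derivative p' x) (at x)"
  shows "(even_part p has_real_derivative odd_part p' x) (at x)"
  unfolding even_part_def[abs_def] odd_part_def refl_fun_def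
  by (auto intro!: derivative_eq_intros assms DERIV_chain2[where f = p, OF assms] simp: field_simps)

lemma odd_part_DERIV:
  assumes "\<And>x. (p has_real_derivative p' x) (at x)"
  shows "(odd_part p has_real_derivative even_part p' x) (at x)"
  unfolding even_part_def odd_part_def[abs_def] refl_fun_def
  by (auto intro!: derivative_eq_intros assms DERIV_chain2[where f = p, OF assms] simp: field_simps)

lemma even_add_odd_part: "even_part f x + odd_part f x = f x"
  by (simp add: even_part_def odd_part_def refl_fun_def field_simps)

lemma aux_sol_climfun:
  "gam \<alpha> \<beta> > 0 \<Longrightarrow> f1 \<in> climfun \<Longrightarrow> f2 \<in> climfun \<Longrightarrow> aux_sol \<alpha> \<beta> f1 f2 \<in> climfun"
  unfolding aux_sol_def by (intro resolv_climfun aux_source_climfun)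

text \<open>Differentiation exchanges parities, while \<open>k1\<close> is odd and \<open>k2\<close>
  is even; hence the scalar equation splits into the system for \<open>u\<close> and
  \<open>W\<close> of the overview.\<close>

lemma aux_sol_parts_DERIV:
  assumes "gam \<alpha> \<beta> > 0" "f1 \<in> climfun" "f2 \<in> climfun"
  shows "(even_part (aux_sol \<alpha> \<beta> f1 f2) has_real_derivative
      gam \<alpha> \<beta> * odd_part (aux_sol \<alpha> \<beta> f1 f2) x + k1 \<alpha> \<beta> f1 f2 x) (at x)"
    and "(odd_part (aux_sol \<alpha> \<beta> f1 f2) has_real_derivative
      gam \<alpha> \<beta> * even_part (aux_sol \<alpha> \<beta> f1 f2) x + gam \<alpha> \<beta> / 2 * k2 f1 f2 x) (at x)"
proof -
  let ?p = "aux_sol \<alpha> \<beta> f1 f2"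
  have D: "(?p has_real_derivative gam \<alpha> \<beta> * ?p x + aux_source \<alpha> \<beta> f1 f2 x) (at x)" for x
    unfolding aux_sol_def by (intro resolv_climfun_ODE aux_source_climfun assms)
  show "(even_part ?p has_real_derivative gam \<alpha> \<beta> * odd_part ?p x + k1 \<alpha> \<beta> f1 f2 x) (at x)"
    by (rule DERIV_cong[OF even_part_DERIV[OF D]])
      (simp add: odd_part_def refl_fun_def aux_source_def parts_simps field_simps)
  show "(odd_part ?p has_real_derivative gam \<alpha> \<beta> * even_part ?p x + gam \<alpha> \<beta> / 2 * k2 f1 f2 x) (at x)"
    by (rule DERIV_cong[OF odd_part_DERIV[OF D]])
      (simp add: even_part_def refl_fun_def aux_source_def parts_simps field_simps)
qed

lemma P_fun_parts:
  assumes "gam \<alpha> \<beta> > 0" "f1 \<in> climfun" "f2 \<in> climfun"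
  defines "p \<equiv> aux_sol \<alpha> \<beta> f1 f2"
  shows "even_part (P_fun1 \<alpha> \<beta> f1 f2) x = even_part f1 x + even_part p x"
    and "even_part (P_fun2 \<alpha> \<beta> f1 f2) x = even_part f2 x - even_part p x"
    and "odd_part (P_fun1 \<alpha> \<beta> f1 f2) x = - (2 * \<alpha> / gam \<alpha> \<beta>) * odd_part p x"
    and "odd_part (P_fun2 \<alpha> \<beta> f1 f2) x = - (2 * \<beta> / gam \<alpha> \<beta>) * odd_part p x"
  by (simp_all add: even_part_def[of "P_fun1 _ _ _ _"] even_part_def[of "P_fun2 _ _ _ _"]
      odd_part_def[of "P_fun1 _ _ _ _"] odd_part_def[of "P_fun2 _ _ _ _"] refl_fun_def
      P_fun_eq[OF assms(1-3)] parts_simps p_def)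

text \<open>The hyperbolic terms of the definition can grow exponentially one by one; that they
  combine to something with limits is visible only through \<open>aux_sol\<close>.\<close>

lemma P_fun_climfun:
  assumes "gam \<alpha> \<beta> > 0" "f1 \<in> climfun" "f2 \<in> climfun"
  shows "P_fun1 \<alpha> \<beta> f1 f2 \<in> climfun" and "P_fun2 \<alpha> \<beta> f1 f2 \<in> climfun"
proof -
  have "(\<lambda>x. (1 * f x + a * g x) + b * h x) \<in> climfun"
    if "f \<in> climfun" "g \<in> climfun" "h \<in> climfun" for f g h a b
    using that by (intro climfun_add climfun_scale)
  note * = this[OF even_part_climfun even_part_climfun odd_part_climfun,
      OF _ aux_sol_climfun aux_sol_climfun]
  have "P_fun1 \<alpha> \<beta> f1 f2 = (\<lambda>x. (1 * even_part f1 x + 1 * even_part (aux_sol \<alpha> \<beta> f1 f2) x)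
      + - (2 * \<alpha> / gam \<alpha> \<beta>) * odd_part (aux_sol \<alpha> \<beta> f1 f2) x)"
    by (simp add: fun_eq_iff P_fun_eq[OF assms])
  then show "P_fun1 \<alpha> \<beta> f1 f2 \<in> climfun" using * assms by (simp only:)
  have "P_fun2 \<alpha> \<beta> f1 f2 = (\<lambda>x. (1 * even_part f2 x + - 1 * even_part (aux_sol \<alpha> \<beta> f1 f2) x)
      + - (2 * \<beta> / gam \<alpha> \<beta>) * odd_part (aux_sol \<alpha> \<beta> f1 f2) x)"
    by (simp add: fun_eq_iff P_fun_eq[OF assms])
  then show "P_fun2 \<alpha> \<beta> f1 f2 \<in> climfun" using * assms by (simp only:)
qed

lemma aux_sol_lincomb:
  assumes "gam \<alpha> \<beta> > 0" "f1 \<in> climfun" "f2 \<in> climfun" "g1 \<in> climfun" "g2 \<in> climfun"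
  shows "aux_sol \<alpha> \<beta> (\<lambda>x. a * f1 x + b * g1 x) (\<lambda>x. a * f2 x + b * g2 x) x
    = a * aux_sol \<alpha> \<beta> f1 f2 x + b * aux_sol \<alpha> \<beta> g1 g2 x"
proof -
  have "aux_source \<alpha> \<beta> (\<lambda>x. a * f1 x + b * g1 x) (\<lambda>x. a * f2 x + b * g2 x)
      = (\<lambda>x. a * aux_source \<alpha> \<beta> f1 f2 x + b * aux_source \<alpha> \<beta> g1 g2 x)"
    by (simp add: fun_eq_iff aux_source_def k1_def k2_def even_part_def odd_part_def refl_fun_def field_simps)
  then show ?thesis
    using assms by (simp add: aux_sol_def resolv_lincomb aux_source_climfun)
qed

lemma P_fun_lincomb:
  assumes "gam \<alpha> \<beta> > 0" "f1 \<in> climfun" "f2 \<in> climfun" "g1 \<in> climfun" "g2 \<in> climfun"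
  shows "P_fun1 \<alpha> \<beta> (\<lambda>x. a * f1 x + b * g1 x) (\<lambda>x. a * f2 x + b * g2 x) x
      = a * P_fun1 \<alpha> \<beta> f1 f2 x + b * P_fun1 \<alpha> \<beta> g1 g2 x"
    and "P_fun2 \<alpha> \<beta> (\<lambda>x. a * f1 x + b * g1 x) (\<lambda>x. a * f2 x + b * g2 x) x
      = a * P_fun2 \<alpha> \<beta> f1 f2 x + b * P_fun2 \<alpha> \<beta> g1 g2 x"
  using assms by (simp_all add: P_fun_eq climfun_lincomb even_part_def odd_part_def refl_fun_def
      aux_sol_lincomb add_divide_distrib diff_divide_distrib algebra_simps)

lemma abs_part_le:
  assumes "\<And>x. \<bar>f x\<bar> \<le> N"
  shows "\<bar>even_part f x\<bar> \<le> N" and "\<bar>odd_part f x\<bar> \<le> (N :: real)"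
  using assms[of x] assms[of "- x"] by (auto simp: even_part_def odd_part_def refl_fun_def)

text \<open>The source is at most \<open>(\<alpha> + \<beta> + gam \<alpha> \<beta>) * N\<close>,
  and solving costs a factor \<open>1 / gam \<alpha> \<beta>\<close>; this is where \<open>K\<close>
  comes from.\<close>

lemma abs_P_fun_le:
  assumes "\<alpha> \<ge> 0" "\<beta> \<ge> 0" and g: "gam \<alpha> \<beta> > 0" and f: "f1 \<in> climfun" "f2 \<in> climfun"
    and N: "\<And>x. \<bar>f1 x\<bar> \<le> N" "\<And>x. \<bar>f2 x\<bar> \<le> N"
  defines "K \<equiv> (\<alpha> + \<beta> + gam \<alpha> \<beta>) / gam \<alpha> \<beta>"
  shows "\<bar>P_fun1 \<alpha> \<beta> f1 f2 x\<bar> \<le> N * (1 + K + 2 * \<alpha> / gam \<alpha> \<beta> * K)"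
    and "\<bar>P_fun2 \<alpha> \<beta> f1 f2 x\<bar> \<le> N * (1 + K + 2 * \<beta> / gam \<alpha> \<beta> * K)"
proof -
  have "\<bar>aux_source \<alpha> \<beta> f1 f2 y\<bar> \<le> (\<alpha> + \<beta> + gam \<alpha> \<beta>) * N" for y
  proof -
    have "\<bar>aux_source \<alpha> \<beta> f1 f2 y\<bar> \<le> (\<bar>\<alpha> * odd_part f1 y\<bar> + \<bar>\<beta> * odd_part f2 y\<bar>)
        + \<bar>gam \<alpha> \<beta> / 2 * (even_part f1 y - even_part f2 y)\<bar>"
      unfolding aux_source_def k1_def k2_def by linarith
    also have "\<dots> \<le> (\<alpha> * N + \<beta> * N) + gam \<alpha> \<beta> / 2 * (2 * N)"
      unfolding abs_mult
      using assms(1,2) g abs_part_le[where f = f1, OF N(1), of y]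
          abs_part_le[where f = f2, OF N(2), of y]
      by (intro add_mono mult_mono) auto
    finally show ?thesis by (simp add: algebra_simps)
  qed
  from abs_resolv_le[OF g climfun_continuous[OF aux_source_climfun[OF f]] this]
  have "\<bar>aux_sol \<alpha> \<beta> f1 f2 y\<bar> \<le> K * N" for y
    by (simp add: aux_sol_def K_def)
  note p = abs_part_le[where f = "aux_sol \<alpha> \<beta> f1 f2", OF this, of x]
  \<comment> \<open>The sign \<open>s\<close> treats both components at once.\<close>
  have *: "\<bar>even_part f x + s * even_part (aux_sol \<alpha> \<beta> f1 f2) x
        - 2 * a / gam \<alpha> \<beta> * odd_part (aux_sol \<alpha> \<beta> f1 f2) x\<bar>
      \<le> N * (1 + K + 2 * a / gam \<alpha> \<beta> * K)"
    if "\<bar>s\<bar> = 1" "a \<ge> 0" "\<bar>even_part f x\<bar> \<le> N" for f a s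
  proof -
    have "\<bar>s * even_part (aux_sol \<alpha> \<beta> f1 f2) x\<bar> \<le> K * N"
      using p that(1) by (simp add: abs_mult)
    moreover have "\<bar>2 * a / gam \<alpha> \<beta> * odd_part (aux_sol \<alpha> \<beta> f1 f2) x\<bar> \<le> 2 * a / gam \<alpha> \<beta> * (K * N)"
      unfolding abs_mult[of "2 * a / gam \<alpha> \<beta>"] using p that(2) g by (intro mult_mono) auto
    moreover have "N * (1 + K + 2 * a / gam \<alpha> \<beta> * K) = N + K * N + 2 * a / gam \<alpha> \<beta> * (K * N)"
      by (simp add: algebra_simps)
    ultimately show ?thesis using that(3) by linarith
  qed
  show "\<bar>P_fun1 \<alpha> \<beta> f1 f2 x\<bar> \<le> N * (1 + K + 2 * \<alpha> / gam \<alpha> \<beta> * K)"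
    using *[of 1 \<alpha> f1] assms(1) abs_part_le[where f = f1, OF N(1)] by (simp add: P_fun_eq[OF g f])
  show "\<bar>P_fun2 \<alpha> \<beta> f1 f2 x\<bar> \<le> N * (1 + K + 2 * \<beta> / gam \<alpha> \<beta> * K)"
    using *[of "-1" \<beta> f2] assms(2) abs_part_le[where f = f2, OF N(2)] by (simp add: P_fun_eq[OF g f])
qed

section \<open>The two subspaces as differential equations\<close>

text \<open>The convolved function is the difference of the even parts plus the sum of the odd
  parts. On the subspace that sum is \<open>(\<alpha> + \<beta>) * w x\<close>, which cancels the
  damping term in the equation for \<open>w\<close>.\<close>

lemma C_space_iff:
  "(u, v) \<in> C_space \<alpha> \<beta> \<longleftrightarrow> (\<exists>W. W 0 = 0
    \<and> (\<forall>x. (W has_real_derivative even_part (apply_clim v) x - even_part (apply_clim u) x) (at x))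
    \<and> (\<forall>x. odd_part (apply_clim u) x = \<alpha> * W x) \<and> (\<forall>x. odd_part (apply_clim v) x = \<beta> * W x))"
  (is "_ \<longleftrightarrow> ?R")
proof -
  let ?g1 = "apply_clim u" and ?g2 = "apply_clim v"
  define h where "h = (\<lambda>y. ?g2 y - refl_fun ?g1 y)"
  define w where "w = conv (exp_fun (\<alpha> + \<beta>)) h"
  have h: "continuous_on UNIV h"
    unfolding h_def
    by (intro continuous_on_diff climfun_continuous climfun_reflect apply_clim)
  have h_eq: "h x = even_part ?g2 x - even_part ?g1 x + odd_part ?g1 x + odd_part ?g2 x" for x
    by (simp add: h_def even_part_def odd_part_def refl_fun_def field_simps)
  have "(u, v) \<in> C_space \<alpha> \<beta> \<longleftrightarrow> (\<forall>x. odd_part ?g1 x = \<alpha> * w x) \<and> (\<forall>x. odd_part ?g2 x = \<beta> * w x)"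
    (is "_ \<longleftrightarrow> ?L") by (simp add: C_space_def Let_def h_def w_def)
  also have "\<dots> \<longleftrightarrow> ?R"
  proof
    assume L: ?L
    have "(w has_real_derivative even_part ?g2 x - even_part ?g1 x) (at x)" for x
      by (rule DERIV_cong[OF conv_exp_ODE(1)[OF h, of "\<alpha> + \<beta>", folded w_def]])
        (use L in \<open>simp add: h_eq algebra_simps\<close>)
    with conv_exp_ODE(2)[OF h, of "\<alpha> + \<beta>", folded w_def] L show ?R by (intro exI[of _ w]) blast
  next
    assume ?R
    then obtain W where W: "W 0 = 0" "\<And>x. odd_part ?g1 x = \<alpha> * W x" "\<And>x. odd_part ?g2 x = \<beta> * W x"
      and D: "\<And>x. (W has_real_derivative even_part ?g2 x - even_part ?g1 x) (at x)" by blast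
    have "(W has_real_derivative h x - (\<alpha> + \<beta>) * W x) (at x)" for x
      by (rule DERIV_cong[OF D]) (simp add: h_eq W algebra_simps)
    from conv_exp_eqI(1)[OF h this W(1), folded w_def] show ?L by (simp add: W)
  qed
  finally show ?thesis .
qed

text \<open>When the even parts are opposite, the convolved function is \<open>k1\<close> plus
  \<open>\<alpha> + \<beta>\<close> times the even part of the second component; the latter term
  again cancels the damping.\<close>

lemma D_space_iff:
  "(u, v) \<in> D_space \<alpha> \<beta> \<longleftrightarrow> (\<forall>x. even_part (apply_clim u) x = - even_part (apply_clim v) x
    \<and> (even_part (apply_clim v) has_real_derivative k1 \<alpha> \<beta> (apply_clim u) (apply_clim v) x) (at x))"
  (is "_ \<longleftrightarrow> ?R")
proof -
  let ?g1 = "apply_clim u" and ?g2 = "apply_clim v"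
  let ?e = "exp_fun (\<alpha> + \<beta>)"
  define h where "h = (\<lambda>y. \<beta> * ?g2 y - \<alpha> * refl_fun ?g1 y)"
  define w where "w = conv ?e h"
  have h: "continuous_on UNIV h"
    unfolding h_def
    by (intro continuous_on_diff continuous_on_mult_left climfun_continuous climfun_reflect apply_clim)
  have h_eq: "h x = \<beta> * even_part ?g2 x - \<alpha> * even_part ?g1 x + k1 \<alpha> \<beta> ?g1 ?g2 x" for x
    by (simp add: h_def even_part_def odd_part_def refl_fun_def k1_def field_simps)
  have e: "(?e has_real_derivative - (\<alpha> + \<beta>) * ?e x) (at x)" for x
    unfolding exp_fun_def[abs_def] by (auto intro!: derivative_eq_intros)
  have "(u, v) \<in> D_space \<alpha> \<beta> \<longleftrightarrow>
      (\<forall>x. even_part ?g1 x = - ?g2 0 * ?e x - w x) \<and> (\<forall>x. even_part ?g2 x = ?g2 0 * ?e x + w x)"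
    (is "_ \<longleftrightarrow> ?L") by (simp add: D_space_def Let_def h_def w_def)
  also have "\<dots> \<longleftrightarrow> ?R"
  proof
    assume L: ?L
    then have eq: "even_part ?g2 = (\<lambda>x. ?g2 0 * ?e x + w x)"
      and eq': "even_part ?g1 x = - even_part ?g2 x" for x
      by (auto simp: fun_eq_iff)
    have "((\<lambda>x. ?g2 0 * ?e x + w x) has_real_derivative k1 \<alpha> \<beta> ?g1 ?g2 x) (at x)" for x
    proof (rule DERIV_cong[OF DERIV_add[OF DERIV_cmult[OF e]
          conv_exp_ODE(1)[OF h, of "\<alpha> + \<beta>", folded w_def]]])
      show "?g2 0 * (- (\<alpha> + \<beta>) * ?e x) + (h x - (\<alpha> + \<beta>) * w x) = k1 \<alpha> \<beta> ?g1 ?g2 x"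
        unfolding h_eq eq' unfolding eq by (simp add: algebra_simps)
    qed
    then show ?R unfolding eq[symmetric] using eq' by blast
  next
    assume R: ?R
    \<comment> \<open>Subtracting the homogeneous solution with the same initial value makes the
      difference vanish at 0, since the even part of \<open>?g2\<close> at 0 is
      \<open>?g2 0\<close>.\<close>
    let ?W = "\<lambda>x. even_part ?g2 x - ?g2 0 * ?e x"
    have "(?W has_real_derivative h x - (\<alpha> + \<beta>) * ?W x) (at x)" for x
    proof (rule DERIV_cong[OF DERIV_diff[OF _ DERIV_cmult[OF e]]])
      show "(even_part ?g2 has_real_derivative k1 \<alpha> \<beta> ?g1 ?g2 x) (at x)" using R by blast
      have "even_part ?g1 x = - even_part ?g2 x" using R by blast
      then show "k1 \<alpha> \<beta> ?g1 ?g2 x - ?g2 0 * (- (\<alpha> + \<beta>) * ?e x) = h x - (\<alpha> + \<beta>) * ?W x"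
        by (simp add: h_eq algebra_simps)
    qed
    moreover have "?W 0 = 0" by (simp add: even_part_def refl_fun_def exp_fun_def)
    ultimately have w: "w x = ?W x" for x unfolding w_def by (rule conv_exp_eqI(1)[OF h])
    show ?L unfolding w using R by simp
  qed
  finally show ?thesis .
qed

section \<open>The operators on pairs\<close>

lemma apply_P_op:
  assumes "gam \<alpha> \<beta> > 0"
  shows "apply_clim (fst (P_op \<alpha> \<beta> (u, v))) = P_fun1 \<alpha> \<beta> (apply_clim u) (apply_clim v)"
    and "apply_clim (snd (P_op \<alpha> \<beta> (u, v))) = P_fun2 \<alpha> \<beta> (apply_clim u) (apply_clim v)"
  using assms by (simp_all add: P_op_def Clim_inverse P_fun_climfun apply_clim)

lemma clim_pair_eqI:
  "(\<And>x. apply_clim (fst f) x = apply_clim (fst g) x) \<Longrightarrow>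
   (\<And>x. apply_clim (snd f) x = apply_clim (snd g) x) \<Longrightarrow> f = g"
  by (simp add: prod_eq_iff fun_eq_iff flip: apply_clim_inject)

lemma P_op_in_C_space:
  assumes g: "gam \<alpha> \<beta> > 0"
  shows "P_op \<alpha> \<beta> f \<in> C_space \<alpha> \<beta>"
proof -
  obtain u v where f: "f = (u, v)" by fastforce
  let ?p = "aux_sol \<alpha> \<beta> (apply_clim u) (apply_clim v)"
  \<comment> \<open>With \<open>p = u - (\<gamma> / 2) W\<close> as in the overview,
    \<open>W\<close> is \<open>- 2 / \<gamma>\<close> times the odd part of
    \<open>p\<close>.\<close>
  let ?W = "\<lambda>x. - (2 / gam \<alpha> \<beta>) * odd_part ?p x"
  note parts = P_fun_parts[OF g apply_clim apply_clim, of u v]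
  have "(fst (P_op \<alpha> \<beta> f), snd (P_op \<alpha> \<beta> f)) \<in> C_space \<alpha> \<beta>"
    unfolding C_space_iff f apply_P_op[OF g] parts
  proof (intro exI[of _ ?W] conjI allI)
    fix x
    show "(?W has_real_derivative even_part (apply_clim v) x - even_part ?p x
        - (even_part (apply_clim u) x + even_part ?p x)) (at x)"
      by (rule DERIV_cong[OF DERIV_cmult[OF aux_sol_parts_DERIV(2)[OF g apply_clim apply_clim]]])
        (use g in \<open>simp add: k2_def field_simps\<close>)
  qed (simp_all add: parts_simps)
  then show ?thesis by simp
qed

text \<open>Here \<open>- (\<gamma> / 2) W\<close> already solves the auxiliary equation, so it is
  \<open>aux_sol\<close>: its even part vanishes and its odd part restores the odd parts of
  \<open>f\<close>.\<close>

lemma P_op_C_space: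
  assumes "\<alpha> + \<beta> > 0" and g: "gam \<alpha> \<beta> > 0" and C: "f \<in> C_space \<alpha> \<beta>"
  shows "P_op \<alpha> \<beta> f = f"
proof -
  obtain u v where f: "f = (u, v)" by fastforce
  let ?f1 = "apply_clim u" and ?f2 = "apply_clim v"
  obtain W where D: "\<And>x. (W has_real_derivative even_part ?f2 x - even_part ?f1 x) (at x)"
    and W: "\<And>x. odd_part ?f1 x = \<alpha> * W x" "\<And>x. odd_part ?f2 x = \<beta> * W x"
    using C unfolding f C_space_iff by blast
  \<comment> \<open>Adding the two relations recovers \<open>W\<close> even if one of the parameters
    is 0, and thus shows that \<open>W\<close> is odd and lies in \<open>climfun\<close>.\<close>
  have W_eq: "W x = 1 / (\<alpha> + \<beta>) * odd_part ?f1 x + 1 / (\<alpha> + \<beta>) * odd_part ?f2 x" for x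
  proof -
    have "(\<alpha> + \<beta>) * W x = odd_part ?f1 x + odd_part ?f2 x" by (simp add: W distrib_right)
    then have "W x = (odd_part ?f1 x + odd_part ?f2 x) / (\<alpha> + \<beta>)"
      using assms(1) by (simp add: eq_divide_eq mult.commute)
    then show ?thesis by (simp add: add_divide_distrib)
  qed
  then have "W = (\<lambda>x. 1 / (\<alpha> + \<beta>) * odd_part ?f1 x + 1 / (\<alpha> + \<beta>) * odd_part ?f2 x)" by blast
  then have "W \<in> climfun"
    by (simp only: climfun_lincomb odd_part_climfun apply_clim)
  have odd: "W (- x) = - W x" for x
    by (simp add: W_eq parts_simps)
  have "aux_sol \<alpha> \<beta> ?f1 ?f2 = (\<lambda>x. - (gam \<alpha> \<beta> / 2) * W x)"
    unfolding aux_sol_def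
  proof (rule resolv_eqI[OF g])
    fix x
    \<comment> \<open>On this subspace \<open>k1\<close> is
      \<open>(\<alpha> * \<alpha> + \<beta> * \<beta>) * W x\<close>, so the identity lets it cancel
      the term \<open>\<gamma> p\<close>.\<close>
    have "gam \<alpha> \<beta> * gam \<alpha> \<beta> * W x = 2 * (\<alpha> * \<alpha> + \<beta> * \<beta>) * W x"
      by (simp only: gam_square)
    then show "((\<lambda>x. - (gam \<alpha> \<beta> / 2) * W x) has_real_derivative
        gam \<alpha> \<beta> * (- (gam \<alpha> \<beta> / 2) * W x) + aux_source \<alpha> \<beta> ?f1 ?f2 x) (at x)"
      by (intro DERIV_cong[OF DERIV_cmult[OF D]])
        (simp add: aux_source_def k1_def k2_def W algebra_simps)
  qed (intro aux_source_climfun climfun_scale apply_clim \<open>W \<in> climfun\<close>)+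
  then have p: "even_part (aux_sol \<alpha> \<beta> ?f1 ?f2) x = 0"
    "odd_part (aux_sol \<alpha> \<beta> ?f1 ?f2) x = - (gam \<alpha> \<beta> / 2) * W x" for x
    by (simp_all add: even_part_def odd_part_def refl_fun_def odd)
  have "P_fun1 \<alpha> \<beta> ?f1 ?f2 x = even_part ?f1 x + odd_part ?f1 x"
    "P_fun2 \<alpha> \<beta> ?f1 ?f2 x = even_part ?f2 x + odd_part ?f2 x" for x
    using g by (simp_all add: P_fun_eq[OF g apply_clim apply_clim] p W)
  then show ?thesis
    by (intro clim_pair_eqI) (simp_all only: f apply_P_op[OF g] even_add_odd_part fst_conv snd_conv)
qed

text \<open>Here \<open>k2\<close> is minus twice the even part of the second component, so that
  even part solves the auxiliary equation: \<open>\<gamma> p\<close> cancels against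
  \<open>(\<gamma> / 2) k2\<close>.\<close>

lemma P_op_D_space:
  assumes g: "gam \<alpha> \<beta> > 0" and D: "f \<in> D_space \<alpha> \<beta>"
  shows "P_op \<alpha> \<beta> f = 0"
proof -
  obtain u v where f: "f = (u, v)" by fastforce
  let ?f1 = "apply_clim u" and ?f2 = "apply_clim v"
  have D: "(even_part ?f2 has_real_derivative k1 \<alpha> \<beta> ?f1 ?f2 x) (at x)"
    and ev: "even_part ?f1 x = - even_part ?f2 x" for x
    using D unfolding f D_space_iff by blast+
  have "aux_sol \<alpha> \<beta> ?f1 ?f2 = even_part ?f2"
    unfolding aux_sol_def
  proof (rule resolv_eqI[OF g])
    fix x
    show "(even_part ?f2 has_real_derivative
        gam \<alpha> \<beta> * even_part ?f2 x + aux_source \<alpha> \<beta> ?f1 ?f2 x) (at x)"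
      by (rule DERIV_cong[OF D]) (simp add: aux_source_def k2_def ev)
  qed (intro aux_source_climfun even_part_climfun apply_clim)+
  then have p: "even_part (aux_sol \<alpha> \<beta> ?f1 ?f2) x = even_part ?f2 x"
    "odd_part (aux_sol \<alpha> \<beta> ?f1 ?f2) x = 0" for x
    by (simp_all add: even_part_def[of "even_part _"] odd_part_def refl_fun_def parts_simps)
  show ?thesis
    by (intro clim_pair_eqI)
      (simp_all add: f apply_P_op[OF g] P_fun_eq[OF g apply_clim apply_clim] p ev zero_clim.rep_eq)
qed

text \<open>The even parts left over are \<open>- u\<close> and \<open>u\<close>. Passing from
  \<open>f\<close> to the remainder changes \<open>k1\<close> by \<open>\<gamma>\<close> times the
  odd part of \<open>p\<close>, which is exactly the extra term in the derivative of
  \<open>u\<close>.\<close>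

lemma Q_op_in_D_space:
  assumes g: "gam \<alpha> \<beta> > 0"
  shows "Q_op \<alpha> \<beta> f \<in> D_space \<alpha> \<beta>"
proof -
  obtain u v where f: "f = (u, v)" by fastforce
  let ?f1 = "apply_clim u" and ?f2 = "apply_clim v"
  let ?p = "aux_sol \<alpha> \<beta> ?f1 ?f2"
  note parts = P_fun_parts[OF g apply_clim apply_clim, of u v]
  have minus: "even_part (apply_clim (a - b)) x = even_part (apply_clim a) x - even_part (apply_clim b) x"
    "odd_part (apply_clim (a - b)) x = odd_part (apply_clim a) x - odd_part (apply_clim b) x" for a b x
    by (simp_all add: even_part_def odd_part_def refl_fun_def minus_clim.rep_eq field_simps)
  let ?h1 = "u - fst (P_op \<alpha> \<beta> f)" and ?h2 = "v - snd (P_op \<alpha> \<beta> f)"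
  have h: "even_part (apply_clim ?h1) x = - even_part ?p x" "even_part (apply_clim ?h2) x = even_part ?p x"
    "odd_part (apply_clim ?h1) x = odd_part ?f1 x + 2 * \<alpha> / gam \<alpha> \<beta> * odd_part ?p x"
    "odd_part (apply_clim ?h2) x = odd_part ?f2 x + 2 * \<beta> / gam \<alpha> \<beta> * odd_part ?p x" for x
    by (simp_all add: minus f apply_P_op[OF g] parts)
  have ev: "even_part (apply_clim ?h2) = even_part ?p" by (simp add: h fun_eq_iff)
  have "(?h1, ?h2) \<in> D_space \<alpha> \<beta>"
    unfolding D_space_iff
  proof (intro allI conjI)
    fix x
    show "even_part (apply_clim ?h1) x = - even_part (apply_clim ?h2) x" by (simp add: h)
    \<comment> \<open>The coefficient by which \<open>k1\<close> changes, evaluated with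
      \<open>gam_square\<close>.\<close>
    have "2 * \<alpha> * \<alpha> / gam \<alpha> \<beta> + 2 * \<beta> * \<beta> / gam \<alpha> \<beta> = gam \<alpha> \<beta>"
      using gam_square[of \<alpha> \<beta>] g by (simp add: field_simps)
    then have "(2 * \<alpha> * \<alpha> / gam \<alpha> \<beta> + 2 * \<beta> * \<beta> / gam \<alpha> \<beta>) * odd_part ?p x = gam \<alpha> \<beta> * odd_part ?p x"
      by (simp only:)
    then have "gam \<alpha> \<beta> * odd_part ?p x + k1 \<alpha> \<beta> ?f1 ?f2 x = k1 \<alpha> \<beta> (apply_clim ?h1) (apply_clim ?h2) x"
      unfolding k1_def h by (simp add: algebra_simps)
    then show "(even_part (apply_clim ?h2) has_real_derivative
        k1 \<alpha> \<beta> (apply_clim ?h1) (apply_clim ?h2) x) (at x)"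
      unfolding ev using aux_sol_parts_DERIV(1)[OF g apply_clim apply_clim, of u v x] by simp
  qed
  moreover have "Q_op \<alpha> \<beta> f = (?h1, ?h2)"
    by (simp add: Q_op_def f minus_prod_def)
  ultimately show ?thesis by simp
qed

lemma abs_apply_clim_le_norm: "\<bar>apply_clim u x\<bar> \<le> norm u"
  unfolding norm_clim_def by (rule cSUP_upper[OF _ bdd_above_clim]) simp

lemma norm_clim_le: "(\<And>x. \<bar>apply_clim u x\<bar> \<le> K) \<Longrightarrow> norm u \<le> K"
  unfolding norm_clim_def by (rule cSUP_least) auto

lemma P_op_bounded_linear:
  assumes "\<alpha> \<ge> 0" "\<beta> \<ge> 0" and g: "gam \<alpha> \<beta> > 0"
  shows "bounded_linear (P_op \<alpha> \<beta>)"
proof -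
  define K where "K = (\<alpha> + \<beta> + gam \<alpha> \<beta>) / gam \<alpha> \<beta>"
  \<comment> \<open>Two scalars cover additivity (\<open>a = b = 1\<close>) and homogeneity
    (\<open>b = 0\<close>) at once.\<close>
  have lin: "P_op \<alpha> \<beta> (a *\<^sub>R f + b *\<^sub>R h) = a *\<^sub>R P_op \<alpha> \<beta> f + b *\<^sub>R P_op \<alpha> \<beta> h" for a b f h
  proof -
    obtain u v u' v' where f: "f = (u, v)" "h = (u', v')" by fastforce
    have comb: "apply_clim (a *\<^sub>R s + b *\<^sub>R t) = (\<lambda>x. a * apply_clim s x + b * apply_clim t x)" for s t
      by (simp add: fun_eq_iff plus_clim.rep_eq scaleR_clim.rep_eq)
    have "a *\<^sub>R f + b *\<^sub>R h = (a *\<^sub>R u + b *\<^sub>R u', a *\<^sub>R v + b *\<^sub>R v')"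
      by (simp add: f)
    then show ?thesis
      by (intro clim_pair_eqI)
        (simp_all add: f apply_P_op[OF g] comb P_fun_lincomb[OF g] apply_clim)
  qed
  show ?thesis
  proof (rule bounded_linear_intro)
    show "P_op \<alpha> \<beta> (f + h) = P_op \<alpha> \<beta> f + P_op \<alpha> \<beta> h" for f h
      using lin[of 1 f 1 h] by simp
    show "P_op \<alpha> \<beta> (r *\<^sub>R f) = r *\<^sub>R P_op \<alpha> \<beta> f" for r f
      using lin[of r f 0 f] by simp
    show "norm (P_op \<alpha> \<beta> f)
        \<le> norm f * ((1 + K + 2 * \<alpha> / gam \<alpha> \<beta> * K) + (1 + K + 2 * \<beta> / gam \<alpha> \<beta> * K))" for f
    proof -
      obtain u v where f: "f = (u, v)" by fastforce
      have "\<bar>apply_clim u x\<bar> \<le> norm f" "\<bar>apply_clim v x\<bar> \<le> norm f" for x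
        using abs_apply_clim_le_norm[of u x] abs_apply_clim_le_norm[of v x]
          norm_fst_le[of u v] norm_snd_le[of v u]
        by (auto simp: f)
      note * = abs_P_fun_le[OF assms apply_clim apply_clim this, folded K_def]
      \<comment> \<open>The product norm is Euclidean: it dominates each component norm and is at
        most their sum, so the supremum estimates carry over.\<close>
      have "norm (P_op \<alpha> \<beta> f) \<le> norm (fst (P_op \<alpha> \<beta> f)) + norm (snd (P_op \<alpha> \<beta> f))"
        using norm_Pair_le[of "fst (P_op \<alpha> \<beta> f)" "snd (P_op \<alpha> \<beta> f)"] by simp
      also have "\<dots> \<le> norm f * (1 + K + 2 * \<alpha> / gam \<alpha> \<beta> * K)
          + norm f * (1 + K + 2 * \<beta> / gam \<alpha> \<beta> * K)"
        using * by (intro add_mono norm_clim_le) (simp_all add: f apply_P_op[OF g])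
      finally show ?thesis by (simp only: distrib_left)
    qed
  qed
qed

section \<open>Complementary projections and the direct sum\<close>

text \<open>Pure linear algebra: every \<open>f\<close> is \<open>P f + (f - P f)\<close>, and on
  the intersection \<open>P\<close> is both the identity and zero.\<close>

lemma projection_direct_sum:
  fixes P :: "'a::real_normed_vector \<Rightarrow> 'a"
  assumes P: "bounded_linear P" and A: "\<And>f. P f \<in> A" "\<And>f. f \<in> A \<Longrightarrow> P f = f"
    and B: "\<And>f. f - P f \<in> B" "\<And>f. f \<in> B \<Longrightarrow> P f = 0"
  shows "is_direct_sum UNIV A B" and "is_projection_on P A" and "is_projection_on (\<lambda>f. f - P f) B"
proof -
  have Q: "bounded_linear (\<lambda>f. f - P f)"
    by (intro bounded_linear_sub bounded_linear_ident P)
  have rA: "range P = A"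
  proof (intro equalityI subsetI)
    show "f \<in> range P" if "f \<in> A" for f
      by (rule range_eqI[of _ _ f]) (simp add: A(2)[OF that])
  qed (use A(1) in auto)
  have rB: "range (\<lambda>f. f - P f) = B"
  proof (intro equalityI subsetI)
    show "f \<in> range (\<lambda>f. f - P f)" if "f \<in> B" for f
      by (rule range_eqI[of _ _ f]) (simp add: B(2)[OF that])
  qed (use B(1) in auto)
  \<comment> \<open>Both sets are ranges of linear maps, so the defining convolution equations need
    not be inspected for closure.\<close>
  have sub: "subspace A" "subspace B"
    using linear_subspace_image[OF bounded_linear.linear[OF P] subspace_UNIV]
      linear_subspace_image[OF bounded_linear.linear[OF Q] subspace_UNIV]
    by (simp_all only: rA rB)
  have "f \<in> A + B" for f
    using set_plus_intro[OF A(1) B(1), of f f] by simp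
  moreover have "f = 0" if "f \<in> A" "f \<in> B" for f
    using A(2)[OF that(1)] B(2)[OF that(2)] by simp
  ultimately have "A + B = UNIV" "A \<inter> B = {0}"
    using subspace_0[OF sub(1)] subspace_0[OF sub(2)] by blast+
  then show "is_direct_sum UNIV A B"
    using sub subspace_UNIV by (simp add: is_direct_sum_def)
  have "P (P f) = P f" "P (f - P f) = 0" for f
    by (rule A(2)[OF A(1)], rule B(2)[OF B(1)])
  then show "is_projection_on P A" "is_projection_on (\<lambda>f. f - P f) B"
    using P Q rA rB by (simp_all add: is_projection_on_def comp_def)
qed

theorem theorem3p3:
  fixes \<alpha> \<beta> :: real
  assumes "\<alpha> \<ge> 0" and "\<beta> \<ge> 0" and "\<alpha> + \<beta> > 0"
  shows "is_direct_sum UNIV (C_space \<alpha> \<beta>) (D_space \<alpha> \<beta>)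
    \<and> (\<forall>f1\<in>climfun. \<forall>f2\<in>climfun. P_fun1 \<alpha> \<beta> f1 f2 \<in> climfun \<and> P_fun2 \<alpha> \<beta> f1 f2 \<in> climfun)
    \<and> is_projection_on (P_op \<alpha> \<beta>) (C_space \<alpha> \<beta>)
    \<and> is_projection_on (Q_op \<alpha> \<beta>) (D_space \<alpha> \<beta>)"
proof -
  have g: "gam \<alpha> \<beta> > 0" using assms by (rule gam_pos)
  have Q: "Q_op \<alpha> \<beta> = (\<lambda>f. f - P_op \<alpha> \<beta> f)" by (simp add: fun_eq_iff Q_op_def)
  note * = projection_direct_sum[OF P_op_bounded_linear[OF assms(1,2) g] P_op_in_C_space[OF g]
      P_op_C_space[OF assms(3) g] Q_op_in_D_space[OF g, unfolded Q] P_op_D_space[OF g]]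
  show ?thesis
    using * P_fun_climfun[OF g] by (simp add: Q)
qed

end
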